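(* Let $(M_p)_{p\in\mathbb{N}_0}$ be a sequence of positive real numbers such that $(M_p/M_0)^{1/p}$, $p\ge 1$, is bounded from below by a positive constant, and let $M(t)=\sup_{p\in\mathbb{N}_0}\log\frac{t^pM_0}{M_p}$, $t>0$, be its associated function. Then the Köthe sequence space $\Lambda_{(M_p)}$ is nuclear if and only if there exists $H>1$ such that $$M(t)+\log t\le M(Ht)+H\qquad\text{for all } t>0.$$
   Context: $\mathbb{N}_0=\mathbb{N}\cup\{0\}$. The space is $$\Lambda_{(M_p)}:=\Big\{(c_k)_{k\in\mathbb{N}_0}\subset\mathbb{C}:\ \text{for any } j\in\mathbb{N}_0,\ \sup_{k\in\mathbb{N}_0}|c_k|e^{M(jk^{1/2})}<+\infty\Big\},$$ endowed with the locally convex topology given by the seminorms $(c_k)\mapsto\sup_{k}|c_k|e^{M(jk^{1/2})}$, $j\in\mathbb{N}_0$. Convention: $M(0):=0$; if $M$ takes the value $+\infty$, then $e^{+\infty}=+\infty$ and $0\cdot(+\infty)=0$. *)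

theory Defs
  imports "HOL-Analysis.Analysis" "HOL-Library.Function_Algebras"
begin

text \<open>
  Complex vector spaces are given as in \<^theory>\<open>HOL.Vector_Spaces\<close> by an additive group
  together with an explicit scalar multiplication \<open>scl\<close>. A topological vector space
  is a topology \<open>T\<close> whose carrier \<open>topspace T\<close> is a linear subspace.
\<close>

definition seminorm_on ::
  "(complex \<Rightarrow> 'a \<Rightarrow> 'a) \<Rightarrow> 'a::ab_group_add set \<Rightarrow> ('a \<Rightarrow> real) \<Rightarrow> bool" where
  "seminorm_on scl E p \<longleftrightarrow>
     (\<forall>x\<in>E. 0 \<le> p x) \<and>
     (\<forall>x\<in>E. \<forall>y\<in>E. p (x + y) \<le> p x + p y) \<and>
     (\<forall>c. \<forall>x\<in>E. p (scl c x) = cmod c * p x)"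

definition functional_on ::
  "(complex \<Rightarrow> 'a \<Rightarrow> 'a) \<Rightarrow> 'a::ab_group_add set \<Rightarrow> ('a \<Rightarrow> complex) \<Rightarrow> bool" where
  "functional_on scl E f \<longleftrightarrow>
     (\<forall>x\<in>E. \<forall>y\<in>E. f (x + y) = f x + f y) \<and>
     (\<forall>c. \<forall>x\<in>E. f (scl c x) = c * f x)"

text \<open>The locally convex topology on \<open>E\<close> defined by a (nonempty) set \<open>P\<close> of seminorms:
  the open semiballs form a subbase.\<close>

definition seminorm_topology ::
  "'a::ab_group_add set \<Rightarrow> ('a \<Rightarrow> real) set \<Rightarrow> 'a topology" where
  "seminorm_topology E P =
     topology_generated_by {{y \<in> E. p (y - x) < r} | p x r. p \<in> P \<and> x \<in> E \<and> 0 < r}"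

definition locally_convex_space ::
  "(complex \<Rightarrow> 'a \<Rightarrow> 'a) \<Rightarrow> 'a::ab_group_add topology \<Rightarrow> bool" where
  "locally_convex_space scl T \<longleftrightarrow>
     vector_space scl \<and> module.subspace scl (topspace T) \<and>
     (\<exists>P. (\<forall>p\<in>P. seminorm_on scl (topspace T) p) \<and> T = seminorm_topology (topspace T) P)"

definition continuous_seminorm ::
  "(complex \<Rightarrow> 'a \<Rightarrow> 'a) \<Rightarrow> 'a::ab_group_add topology \<Rightarrow> ('a \<Rightarrow> real) \<Rightarrow> bool" where
  "continuous_seminorm scl T p \<longleftrightarrow>
     seminorm_on scl (topspace T) p \<and> continuous_map T euclideanreal p"

text \<open>The norm of a functional on \<open>(E, q)\<close>. It is meaningful only for bounded functionals:
  the real supremum of an unbounded set is a junk value.\<close>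

definition bounded_functional ::
  "(complex \<Rightarrow> 'a \<Rightarrow> 'a) \<Rightarrow> 'a::ab_group_add set \<Rightarrow> ('a \<Rightarrow> real) \<Rightarrow> ('a \<Rightarrow> complex) \<Rightarrow> bool" where
  "bounded_functional scl E q f \<longleftrightarrow>
     functional_on scl E f \<and> (\<exists>C. \<forall>x\<in>E. cmod (f x) \<le> C * q x)"

definition dual_norm :: "'a set \<Rightarrow> ('a \<Rightarrow> real) \<Rightarrow> ('a \<Rightarrow> complex) \<Rightarrow> real" where
  "dual_norm E q f = (SUP x\<in>{x\<in>E. q x \<le> 1}. cmod (f x))"

text \<open>
  Nuclearity of a linear map \<open>t\<close> from \<open>(E, q)\<close> to \<open>(F, p)\<close> in the sense of Pietsch:
  \<open>t x = (\<Sum>n. a\<^sub>n(x) y\<^sub>n)\<close> with \<open>(\<Sum>n. \<parallel>a\<^sub>n\<parallel> p(y\<^sub>n)) < \<infinity>\<close>.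
  The spaces are only seminormed. A functional bounded by \<open>q\<close> vanishes on the kernel of \<open>q\<close>,
  so the functionals \<open>a\<^sub>n\<close> are exactly the elements of the dual of the normed space
  \<open>E / ker q\<close>, with the same norm, and convergence with respect to \<open>p\<close> is convergence in the
  normed space \<open>F / ker p\<close>.
\<close>

definition nuclear_map ::
  "(complex \<Rightarrow> 'a \<Rightarrow> 'a) \<Rightarrow> 'a::ab_group_add set \<Rightarrow> ('a \<Rightarrow> real) \<Rightarrow>
   (complex \<Rightarrow> 'b \<Rightarrow> 'b) \<Rightarrow> 'b::ab_group_add set \<Rightarrow> ('b \<Rightarrow> real) \<Rightarrow> ('a \<Rightarrow> 'b) \<Rightarrow> bool" where
  "nuclear_map sclE E q sclF F p t \<longleftrightarrow>
     (\<exists>(a :: nat \<Rightarrow> 'a \<Rightarrow> complex) (y :: nat \<Rightarrow> 'b).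
        (\<forall>n. bounded_functional sclE E q (a n)) \<and> (\<forall>n. y n \<in> F) \<and>
        summable (\<lambda>n. dual_norm E q (a n) * p (y n)) \<and>
        (\<forall>x\<in>E. (\<lambda>N. p (t x - (\<Sum>n<N. sclF (a n x) (y n)))) \<longlonglongrightarrow> 0))"

text \<open>
  A locally convex space \<open>E\<close> is nuclear if every continuous seminorm \<open>p\<close> is dominated by a
  continuous seminorm \<open>q\<close> such that the canonical map \<open>E / ker q \<rightarrow> E / ker p\<close>, which is induced
  by the identity of \<open>E\<close>, is nuclear.
\<close>

definition nuclear_space ::
  "(complex \<Rightarrow> 'a \<Rightarrow> 'a) \<Rightarrow> 'a::ab_group_add topology \<Rightarrow> bool" where
  "nuclear_space scl T \<longleftrightarrow>
     locally_convex_space scl T \<and>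
     (\<forall>p. continuous_seminorm scl T p \<longrightarrow>
        (\<exists>q. continuous_seminorm scl T q \<and> (\<forall>x\<in>topspace T. p x \<le> q x) \<and>
             nuclear_map scl (topspace T) q scl (topspace T) p (\<lambda>x. x)))"

definition ereal_exp :: "ereal \<Rightarrow> ereal" where
  "ereal_exp x = (case x of ereal r \<Rightarrow> ereal (exp r) | PInfty \<Rightarrow> \<infinity> | MInfty \<Rightarrow> 0)"

definition associated_function :: "(nat \<Rightarrow> real) \<Rightarrow> real \<Rightarrow> ereal" where
  "associated_function M t =
     (if t = 0 then 0 else (SUP p. ereal (ln (t ^ p * M 0 / M p))))"

text \<open>Note that \<open>0 * \<infinity> = 0\<close> in \<^typ>\<open>ereal\<close>.\<close>

definition kothe_sup :: "(nat \<Rightarrow> real) \<Rightarrow> nat \<Rightarrow> (nat \<Rightarrow> complex) \<Rightarrow> ereal" where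
  "kothe_sup M j c =
     (SUP k. ereal (cmod (c k)) * ereal_exp (associated_function M (real j * sqrt (real k))))"

definition kothe_space :: "(nat \<Rightarrow> real) \<Rightarrow> (nat \<Rightarrow> complex) set" where
  "kothe_space M = {c. \<forall>j. kothe_sup M j c < \<infinity>}"

definition kothe_seminorm :: "(nat \<Rightarrow> real) \<Rightarrow> nat \<Rightarrow> (nat \<Rightarrow> complex) \<Rightarrow> real" where
  "kothe_seminorm M j c = real_of_ereal (kothe_sup M j c)"

definition kothe_topology :: "(nat \<Rightarrow> real) \<Rightarrow> (nat \<Rightarrow> complex) topology" where
  "kothe_topology M = seminorm_topology (kothe_space M) (range (kothe_seminorm M))"

definition seq_scale :: "complex \<Rightarrow> (nat \<Rightarrow> complex) \<Rightarrow> nat \<Rightarrow> complex" where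
  "seq_scale a c = (\<lambda>k. a * c k)"

lemma topspace_seminorm_topology:
  assumes "P \<noteq> {}"
  shows "topspace (seminorm_topology E P) = E"
proof -
  obtain p where p: "p \<in> P" using assms by blast
  have "c \<in> \<Union> {{y \<in> E. p (y - x) < r} | p x r. p \<in> P \<and> x \<in> E \<and> 0 < r}" if c: "c \<in> E" for c
  proof (rule UnionI)
    show "{y \<in> E. p (y - c) < \<bar>p 0\<bar> + 1}
        \<in> {{y \<in> E. p (y - x) < r} | p x r. p \<in> P \<and> x \<in> E \<and> 0 < r}"
      using p c by (intro CollectI exI[of _ p] exI[of _ c] exI[of _ "\<bar>p 0\<bar> + 1"]) auto
    show "c \<in> {y \<in> E. p (y - c) < \<bar>p 0\<bar> + 1}"
      using c by auto
  qed
  then show ?thesis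
    unfolding seminorm_topology_def topology_generated_by_topspace by auto
qed

lemma topspace_kothe_topology: "topspace (kothe_topology M) = kothe_space M"
  by (simp add: kothe_topology_def topspace_seminorm_topology)

end

theory Submission
  imports Defs
begin

text \<open>
  Write \<open>w\<^sub>j(k) = exp (M(j k\<^sup>1\<^sup>/\<^sup>2))\<close>. If \<open>M\<close> is finite and the identity of the space is nuclear
  between the norms with weights \<open>w\<^sub>l\<close> and \<open>w\<^sub>1\<close>, then expanding the unit sequences in the nuclear
  representation gives \<open>\<Sum>\<^sub>k w\<^sub>1(k) / w\<^sub>l(k) < \<infinity>\<close>. Since \<open>M\<close> is convex in \<open>log t\<close>, the terms
  decrease for \<open>k \<ge> 1\<close>, so \<open>k w\<^sub>1(k) / w\<^sub>l(k)\<close> is bounded, which is the growth condition at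
  \<open>t = k\<^sup>1\<^sup>/\<^sup>2\<close>. If \<open>M\<close> takes the value \<open>\<infinity>\<close>, the growth condition holds automatically.
  Conversely, four iterations of the growth condition give \<open>w\<^sub>j(k) (k + 1)\<^sup>2 \<le> C w\<^sub>l(k)\<close>, so the
  expansion along the unit sequences is a nuclear representation.
\<close>

section \<open>Seminorms and the topology they generate\<close>

lemma seminorm_on_0:
  assumes "vector_space scl" "seminorm_on scl E p" "0 \<in> E"
  shows "p 0 = 0"
proof -
  interpret vector_space scl by fact
  have "p (scl 0 0) = cmod 0 * p 0"
    using assms(2,3) unfolding seminorm_on_def by blast
  then show ?thesis by simp
qed

lemma seminorm_on_minus_commute:
  assumes "vector_space scl" "module.subspace scl E" "seminorm_on scl E p" "x \<in> E" "y \<in> E"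
  shows "p (x - y) = p (y - x)"
proof -
  interpret vector_space scl by fact
  have "y - x \<in> E" using assms(2,4,5) subspace_diff by blast
  then have "p (scl (- 1) (y - x)) = cmod (- 1) * p (y - x)"
    using assms(3) unfolding seminorm_on_def by blast
  then show ?thesis by simp
qed

lemma seminorm_on_diff_le:
  assumes "vector_space scl" "module.subspace scl E" "seminorm_on scl E p"
    and "x \<in> E" "y \<in> E" "z \<in> E"
  shows "p (x - z) \<le> p (x - y) + p (y - z)"
proof -
  interpret vector_space scl by fact
  have "p ((x - y) + (y - z)) \<le> p (x - y) + p (y - z)"
    using assms(2-6) subspace_diff unfolding seminorm_on_def by blast
  then show ?thesis by simp
qed

lemma seminorm_on_scale:
  assumes "seminorm_on scl E p" "0 \<le> C"
  shows "seminorm_on scl E (\<lambda>x. C * p x)"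
  unfolding seminorm_on_def
proof (intro conjI ballI allI)
  fix x y assume xy: "x \<in> E" "y \<in> E"
  have "C * p (x + y) \<le> C * (p x + p y)"
    using assms xy unfolding seminorm_on_def by (intro mult_left_mono) auto
  then show "C * p (x + y) \<le> C * p x + C * p y" by (simp add: algebra_simps)
qed (use assms in \<open>auto simp: seminorm_on_def\<close>)

text \<open>By the reverse triangle inequality, \<open>p\<close> maps the semiball of radius
  \<open>r\<close> about \<open>x\<close> into the interval of radius \<open>r\<close> about
  \<open>p x\<close>.\<close>

lemma continuous_map_seminorm_topology:
  assumes vs: "vector_space scl" and sub: "module.subspace scl E"
    and P: "p \<in> P" and sn: "seminorm_on scl E p"
  shows "continuous_map (seminorm_topology E P) euclideanreal p"
proof -
  interpret vector_space scl by fact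
  have top: "topspace (seminorm_topology E P) = E"
    using P by (intro topspace_seminorm_topology) auto
  have "openin (seminorm_topology E P) {x \<in> E. p x \<in> U}" if U: "open U" for U
  proof (subst openin_subopen, intro ballI)
    fix x assume x: "x \<in> {x \<in> E. p x \<in> U}"
    then obtain r where r: "0 < r" "\<And>s. \<bar>s - p x\<bar> < r \<Longrightarrow> s \<in> U"
      using openE[OF U, of "p x"] by (auto simp: ball_def dist_real_def subset_iff abs_minus_commute)
    let ?B = "{y \<in> E. p (y - x) < r}"
    have "openin (seminorm_topology E P) ?B"
      unfolding seminorm_topology_def
      by (rule topology_generated_by_Basis) (use P x r in blast)
    moreover have "x \<in> ?B"
      using x r seminorm_on_0[OF vs sn] subspace_0[OF sub] by simp
    moreover have "?B \<subseteq> {x \<in> E. p x \<in> U}"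
    proof
      fix y assume y: "y \<in> ?B"
      have E: "x \<in> E" "y \<in> E" "0 \<in> E" using x y subspace_0[OF sub] by auto
      have "p y \<le> p (y - x) + p x" "p x \<le> p (y - x) + p y"
        using seminorm_on_diff_le[OF vs sub sn E(2,1,3)] seminorm_on_diff_le[OF vs sub sn E(1,2,3)]
          seminorm_on_minus_commute[OF vs sub sn E(1,2)] by simp_all
      then show "y \<in> {x \<in> E. p x \<in> U}" using y r by auto
    qed
    ultimately show "\<exists>T. openin (seminorm_topology E P) T \<and> x \<in> T \<and> T \<subseteq> {x \<in> E. p x \<in> U}"
      by blast
  qed
  then show ?thesis by (simp add: continuous_map_def top)
qed

text \<open>Because the seminorms increase with the index, finitely many semiballs about
  \<open>x\<close> contain a single one, with the largest index and the smallest radius. A subbasic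
  semiball with another centre is recentred at \<open>x\<close> by the triangle inequality.\<close>

lemma openin_seminorm_topologyD:
  fixes p :: "nat \<Rightarrow> 'a::ab_group_add \<Rightarrow> real"
  assumes vs: "vector_space scl" and sub: "module.subspace scl E"
    and sn: "\<And>j. seminorm_on scl E (p j)"
    and mono: "\<And>i j x. i \<le> j \<Longrightarrow> x \<in> E \<Longrightarrow> p i x \<le> p j x"
    and U: "openin (seminorm_topology E (range p)) U" "x \<in> U"
  shows "\<exists>j r. 0 < r \<and> {y \<in> E. p j (y - x) < r} \<subseteq> U"
proof -
  interpret vector_space scl by fact
  have xE: "x \<in> E"
    using openin_subset[OF U(1)] U(2) topspace_seminorm_topology[of "range p" E] by auto
  have "generate_topology_on {{y \<in> E. q (y - z) < r} | q z r. q \<in> range p \<and> z \<in> E \<and> 0 < r} U"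
    using U(1) unfolding seminorm_topology_def openin_topology_generated_by_iff .
  then show ?thesis using U(2)
  proof (induction U rule: generate_topology_on.induct)
    case (Int a b)
    then obtain i r j s where *: "0 < r" "{y \<in> E. p i (y - x) < r} \<subseteq> a"
      "0 < s" "{y \<in> E. p j (y - x) < s} \<subseteq> b" by auto
    have "{y \<in> E. p (max i j) (y - x) < min r s} \<subseteq> a \<inter> b"
    proof
      fix y assume y: "y \<in> {y \<in> E. p (max i j) (y - x) < min r s}"
      then have "y - x \<in> E" using xE sub subspace_diff by auto
      then have "p i (y - x) < r" "p j (y - x) < s"
        using y mono[of i "max i j" "y - x"] mono[of j "max i j" "y - x"] by auto
      then show "y \<in> a \<inter> b" using * y by auto
    qed
    then show ?case using * by (intro exI[of _ "max i j"] exI[of _ "min r s"]) auto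
  next
    case (UN K)
    then obtain k where k: "k \<in> K" "x \<in> k" by blast
    then show ?case using UN.IH[OF k] by blast
  next
    case (Basis s)
    then obtain i z r where s: "s = {y \<in> E. p i (y - z) < r}" "z \<in> E" by auto
    have "{y \<in> E. p i (y - x) < r - p i (x - z)} \<subseteq> s"
      using seminorm_on_diff_le[OF vs sub sn[of i] _ xE s(2)] unfolding s(1) by force
    moreover have "0 < r - p i (x - z)" using Basis.prems s by auto
    ultimately show ?case by blast
  qed auto
qed

text \<open>Continuity at 0 gives a semiball of some \<open>p j\<close> on which
  \<open>q < 1\<close>; homogeneity turns this inclusion into a linear bound.\<close>

lemma continuous_seminorm_bound:
  fixes p :: "nat \<Rightarrow> 'a::ab_group_add \<Rightarrow> real"
  assumes vs: "vector_space scl" and sub: "module.subspace scl E"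
    and sn: "\<And>j. seminorm_on scl E (p j)"
    and mono: "\<And>i j x. i \<le> j \<Longrightarrow> x \<in> E \<Longrightarrow> p i x \<le> p j x"
    and q: "continuous_seminorm scl (seminorm_topology E (range p)) q"
  shows "\<exists>C j. 0 < C \<and> (\<forall>x\<in>E. q x \<le> C * p j x)"
proof -
  interpret vector_space scl by fact
  have top: "topspace (seminorm_topology E (range p)) = E"
    by (intro topspace_seminorm_topology) auto
  have qsn: "seminorm_on scl E q" using q top by (simp add: continuous_seminorm_def)
  have "openin (seminorm_topology E (range p)) {x \<in> E. q x \<in> {..<1}}"
    using q top unfolding continuous_seminorm_def continuous_map_def
    by (metis open_lessThan open_openin)
  moreover have "0 \<in> {x \<in> E. q x \<in> {..<1}}"
    using seminorm_on_0[OF vs qsn] subspace_0[OF sub] by simp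
  ultimately have "\<exists>j r. 0 < r \<and> {y \<in> E. p j (y - 0) < r} \<subseteq> {x \<in> E. q x \<in> {..<1}}"
    using vs sub sn mono by (intro openin_seminorm_topologyD)
  then obtain j r where r: "0 < r" "{y \<in> E. p j (y - 0) < r} \<subseteq> {x \<in> E. q x \<in> {..<1}}"
    by blast
  have "q x \<le> 2 / r * p j x" if x: "x \<in> E" for x
  proof (rule field_le_epsilon)
    fix e :: real assume e: "0 < e"
    have px: "0 \<le> p j x" using sn x unfolding seminorm_on_def by blast
    \<comment> \<open>Since \<open>p j x\<close> may be 0, it cannot serve as the scaling factor.
      The summand with \<open>e\<close> makes \<open>d\<close> positive and contributes exactly
      \<open>e\<close> to the final bound \<open>2 * d / r\<close>.\<close>
    define d where "d = p j x + e * r / 2"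
    have d: "0 < d" using px e r by (simp add: d_def add_nonneg_pos)
    have s: "scl (complex_of_real (r / (2 * d))) x \<in> E" using sub x subspace_scale by blast
    have sc: "p j (scl (complex_of_real (r / (2 * d))) x) = r / (2 * d) * p j x"
      "q (scl (complex_of_real (r / (2 * d))) x) = r / (2 * d) * q x"
      using sn[of j] qsn x d r(1) unfolding seminorm_on_def by (auto simp: norm_divide norm_mult)
    have "p j x < 2 * d" using mult_pos_pos[OF e r(1)] px unfolding d_def by simp
    then have "r / (2 * d) * p j x < r" using d r(1) by (simp add: field_simps)
    then have "r / (2 * d) * q x < 1" using r(2) s sc by auto
    then have "q x \<le> 2 * d / r" using d r(1) by (simp add: field_simps)
    then show "q x \<le> 2 / r * p j x + e" using r(1) by (simp add: d_def field_simps)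
  qed
  then show ?thesis using r(1) by (intro exI[of _ "2 / r"] exI[of _ j]) auto
qed

section \<open>Bounded functionals and the dual norm\<close>

lemma bdd_above_dual_norm:
  assumes sn: "seminorm_on scl E q" and f: "bounded_functional scl E q f"
  shows "bdd_above ((\<lambda>x. cmod (f x)) ` {x \<in> E. q x \<le> 1})"
proof -
  obtain C where C: "\<And>x. x \<in> E \<Longrightarrow> cmod (f x) \<le> C * q x"
    using f unfolding bounded_functional_def by blast
  show ?thesis
  proof (rule bdd_aboveI2)
    fix z assume "z \<in> {x \<in> E. q x \<le> 1}"
    then have z: "z \<in> E" "q z \<le> 1" "0 \<le> q z" using sn unfolding seminorm_on_def by auto
    have "C * q z \<le> \<bar>C\<bar> * 1" using z by (intro mult_mono) auto
    then show "cmod (f z) \<le> \<bar>C\<bar>" using C[OF z(1)] by simp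
  qed
qed

text \<open>If \<open>q x > 0\<close>, scale \<open>x\<close> to the unit sphere of
  \<open>q\<close>. If \<open>q x = 0\<close>, the bound that makes \<open>f\<close> a bounded
  functional already forces \<open>f x = 0\<close>.\<close>

lemma bounded_functional_le_dual_norm:
  assumes sn: "seminorm_on scl E q" and cl: "\<And>c x. x \<in> E \<Longrightarrow> scl c x \<in> E"
    and f: "bounded_functional scl E q f" and x: "x \<in> E"
  shows "cmod (f x) \<le> dual_norm E q f * q x"
proof (cases "q x = 0")
  case True
  obtain C where "cmod (f x) \<le> C * q x"
    using f x unfolding bounded_functional_def by blast
  then show ?thesis using True by simp
next
  case False
  then have q0: "0 < q x" using sn x unfolding seminorm_on_def by (metis order_less_le)
  let ?c = "complex_of_real (1 / q x)"
  have "q (scl ?c x) = cmod ?c * q x"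
    using sn x unfolding seminorm_on_def by blast
  then have "scl ?c x \<in> {x \<in> E. q x \<le> 1}" using cl x q0 by (simp add: norm_divide)
  then have "cmod (f (scl ?c x)) \<le> dual_norm E q f"
    unfolding dual_norm_def by (intro cSUP_upper bdd_above_dual_norm[OF sn f])
  moreover have "f (scl ?c x) = ?c * f x"
    using f x unfolding bounded_functional_def functional_on_def by blast
  ultimately have "1 / q x * cmod (f x) \<le> dual_norm E q f" using q0 by (simp add: norm_mult norm_divide)
  then show ?thesis using q0 by (simp add: field_simps)
qed

lemma dual_norm_le:
  assumes "0 \<in> E" "q 0 = 0" "0 \<le> B" "\<And>x. x \<in> E \<Longrightarrow> cmod (f x) \<le> B * q x"
  shows "dual_norm E q f \<le> B"
  unfolding dual_norm_def
proof (rule cSUP_least)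
  show "{x \<in> E. q x \<le> 1} \<noteq> {}" using assms by auto
  fix x assume "x \<in> {x \<in> E. q x \<le> 1}"
  then show "cmod (f x) \<le> B"
    using assms(3) assms(4)[of x] mult_left_mono[of "q x" 1 B] by auto
qed

lemma dual_norm_nonneg:
  assumes "seminorm_on scl E q" "bounded_functional scl E q f" "0 \<in> E" "q 0 = 0"
  shows "0 \<le> dual_norm E q f"
proof -
  have "cmod (f 0) \<le> dual_norm E q f"
    unfolding dual_norm_def using assms by (intro cSUP_upper bdd_above_dual_norm) auto
  then show ?thesis using norm_ge_zero order_trans by blast
qed

lemma functional_on_sum:
  assumes f: "functional_on scl E f" and vs: "vector_space scl" and sub: "module.subspace scl E"
    and z: "\<And>i. i \<in> I \<Longrightarrow> z i \<in> E"
  shows "f (\<Sum>i\<in>I. scl (c i) (z i)) = (\<Sum>i\<in>I. c i * f (z i))"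
proof -
  interpret vector_space scl by fact
  have "f (scl 0 0) = 0 * f 0"
    using f subspace_0[OF sub] unfolding functional_on_def by blast
  then have f0: "f 0 = 0" by simp
  show ?thesis using z
  proof (induction I rule: infinite_finite_induct)
    case (insert i I)
    then have "scl (c i) (z i) \<in> E" "(\<Sum>i\<in>I. scl (c i) (z i)) \<in> E"
      using sub by (auto intro!: subspace_scale subspace_sum)
    then show ?case using insert f unfolding functional_on_def by simp
  qed (simp_all add: f0)
qed

section \<open>The Koethe sequence space: weights, seminorms and unit sequences\<close>

lemma vector_space_seq_scale: "vector_space seq_scale"
  by unfold_locales (auto simp: seq_scale_def plus_fun_def algebra_simps)

lemma sum_fun_apply: "(\<Sum>i\<in>I. f i) k = (\<Sum>i\<in>I. f i k)"
  by (induction I rule: infinite_finite_induct) (auto simp: plus_fun_def zero_fun_def)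

definition unit_seq :: "nat \<Rightarrow> nat \<Rightarrow> complex" where
  "unit_seq k = (\<lambda>i. if i = k then 1 else 0)"

lemma ereal_exp_mono: "x \<le> y \<Longrightarrow> ereal_exp x \<le> ereal_exp y"
  by (cases x; cases y) (auto simp: ereal_exp_def)

lemma ereal_exp_nonneg: "0 \<le> ereal_exp x"
  by (cases x) (auto simp: ereal_exp_def)

text \<open>Separates the convention \<open>0 * \<infinity> = 0\<close> from real arithmetic: an
  infinite weight forces the coefficient to vanish, while a finite weight leaves a real
  inequality.\<close>

lemma ereal_mult_le_iff:
  assumes "0 \<le> a" "1 \<le> v"
  shows "ereal a * v \<le> ereal B \<longleftrightarrow>
    (v = \<infinity> \<longrightarrow> a = 0 \<and> 0 \<le> B) \<and> (v \<noteq> \<infinity> \<longrightarrow> a * real_of_ereal v \<le> B)"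
  using assms by (cases v) (auto simp: zero_ereal_def[symmetric])

definition kothe_weight :: "(nat \<Rightarrow> real) \<Rightarrow> nat \<Rightarrow> nat \<Rightarrow> ereal" where
  "kothe_weight M j k = ereal_exp (associated_function M (real j * sqrt (real k)))"

text \<open>An infinite weight becomes 0 here, so lower bounds and monotonicity hold only under a
  finiteness hypothesis.\<close>

abbreviation real_weight :: "(nat \<Rightarrow> real) \<Rightarrow> nat \<Rightarrow> nat \<Rightarrow> real" where
  "real_weight M j k \<equiv> real_of_ereal (kothe_weight M j k)"

context
  fixes M :: "nat \<Rightarrow> real"
  assumes M_pos: "\<And>p. 0 < M p"
begin

text \<open>The term with \<open>p = 0\<close> in the supremum is \<open>ln 1 = 0\<close>.\<close>

lemma associated_function_nonneg: "0 \<le> associated_function M t"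
proof (cases "t = 0")
  case False
  have "ereal (ln (t ^ 0 * M 0 / M 0)) \<le> associated_function M t"
    using False SUP_upper[of 0 UNIV "\<lambda>p. ereal (ln (t ^ p * M 0 / M p))"]
    by (simp only: associated_function_def if_False UNIV_I)
  then show ?thesis using M_pos[of 0] by (simp flip: zero_ereal_def)
qed (simp add: associated_function_def)

lemma associated_function_mono:
  assumes "0 \<le> s" "s \<le> t"
  shows "associated_function M s \<le> associated_function M t"
proof (cases "s = 0")
  case True
  then show ?thesis using associated_function_nonneg by (simp add: associated_function_def[of _ 0])
next
  case False
  then have s: "0 < s" "0 < t" using assms by auto
  have "ln (s ^ p * M 0 / M p) \<le> ln (t ^ p * M 0 / M p)" for p
    using s M_pos assms
    by (subst ln_le_cancel_iff) (auto intro!: divide_right_mono mult_right_mono power_mono simp: less_imp_le)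
  then show ?thesis
    using s unfolding associated_function_def by (auto intro!: SUP_mono')
qed

lemma kothe_weight_ge_1: "1 \<le> kothe_weight M j k"
  using ereal_exp_mono[OF associated_function_nonneg]
  by (simp add: kothe_weight_def ereal_exp_def zero_ereal_def one_ereal_def)

lemma kothe_weight_mono: "i \<le> j \<Longrightarrow> kothe_weight M i k \<le> kothe_weight M j k"
  unfolding kothe_weight_def
  by (intro ereal_exp_mono associated_function_mono) (auto intro: mult_right_mono)

lemma real_weight_ge_1: "kothe_weight M j k \<noteq> \<infinity> \<Longrightarrow> 1 \<le> real_weight M j k"
  using kothe_weight_ge_1[of j k] by (cases "kothe_weight M j k") auto

lemma real_weight_nonneg: "0 \<le> real_weight M j k"
  using kothe_weight_ge_1[of j k] by (cases "kothe_weight M j k") auto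

lemma real_weight_mono:
  assumes "i \<le> j" "kothe_weight M j k \<noteq> \<infinity>"
  shows "real_weight M i k \<le> real_weight M j k"
  using kothe_weight_mono[OF assms(1), of k] kothe_weight_ge_1[of i k] assms(2)
  by (cases "kothe_weight M i k"; cases "kothe_weight M j k") auto

lemma kothe_sup_le_iff:
  "kothe_sup M j c \<le> ereal B \<longleftrightarrow>
    (\<forall>k. (kothe_weight M j k = \<infinity> \<longrightarrow> c k = 0 \<and> 0 \<le> B) \<and>
      (kothe_weight M j k \<noteq> \<infinity> \<longrightarrow> cmod (c k) * real_weight M j k \<le> B))"
  unfolding kothe_sup_def kothe_weight_def[symmetric] SUP_le_iff
  by (simp add: ereal_mult_le_iff[OF norm_ge_zero kothe_weight_ge_1])

lemma kothe_sup_nonneg: "0 \<le> kothe_sup M j c"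
proof -
  have "0 \<le> ereal (cmod (c 0)) * kothe_weight M j 0"
    by (simp add: kothe_weight_def ereal_exp_nonneg)
  also have "\<dots> \<le> kothe_sup M j c"
    unfolding kothe_sup_def kothe_weight_def by (rule SUP_upper) simp
  finally show ?thesis .
qed

lemma kothe_seminorm_nonneg: "0 \<le> kothe_seminorm M j c"
  unfolding kothe_seminorm_def by (intro real_of_ereal_pos kothe_sup_nonneg)

text \<open>On the space the supremum is finite, so \<open>real_of_ereal\<close> loses
  nothing.\<close>

lemma kothe_spaceD:
  assumes "c \<in> kothe_space M"
  shows "kothe_sup M j c = ereal (kothe_seminorm M j c)"
proof -
  have "kothe_sup M j c < \<infinity>" using assms by (simp add: kothe_space_def)
  then show ?thesis
    using kothe_sup_nonneg[of j c] unfolding kothe_seminorm_def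
    by (cases "kothe_sup M j c") auto
qed

lemma kothe_space_eq_0:
  assumes "c \<in> kothe_space M" "kothe_weight M j k = \<infinity>"
  shows "c k = 0"
  using kothe_sup_le_iff[of j c "kothe_seminorm M j c"] kothe_spaceD[OF assms(1), of j] assms(2)
  by auto

lemma kothe_seminorm_ge:
  assumes "c \<in> kothe_space M"
  shows "cmod (c k) * real_weight M j k \<le> kothe_seminorm M j c"
  using kothe_sup_le_iff[of j c "kothe_seminorm M j c"] kothe_spaceD[OF assms, of j]
    kothe_seminorm_nonneg[of j c]
  by (cases "kothe_weight M j k = \<infinity>") auto

text \<open>All weights are at least 1. Hence the coordinate functionals are bounded, and
  convergence in any of the seminorms implies convergence of every coordinate.\<close>

lemma cmod_le_kothe_seminorm:
  assumes "c \<in> kothe_space M"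
  shows "cmod (c k) \<le> kothe_seminorm M j c"
proof (cases "kothe_weight M j k = \<infinity>")
  case True
  then show ?thesis using kothe_space_eq_0[OF assms True] kothe_seminorm_nonneg by simp
next
  case False
  then show ?thesis
    using kothe_seminorm_ge[OF assms, of k j] mult_left_mono[OF real_weight_ge_1[OF False], of "cmod (c k)"]
    by simp
qed

lemma kothe_spaceI:
  assumes "\<And>j k. kothe_weight M j k = \<infinity> \<Longrightarrow> c k = 0"
    and "\<And>j. \<exists>B. \<forall>k. kothe_weight M j k \<noteq> \<infinity> \<longrightarrow> cmod (c k) * real_weight M j k \<le> B"
  shows "c \<in> kothe_space M"
  unfolding kothe_space_def
proof (intro CollectI allI)
  fix j
  obtain B where "\<forall>k. kothe_weight M j k \<noteq> \<infinity> \<longrightarrow> cmod (c k) * real_weight M j k \<le> B"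
    using assms(2) by blast
  \<comment> \<open>Coordinates with an infinite weight ask for a nonnegative bound, hence the
    maximum with 0.\<close>
  then have "kothe_sup M j c \<le> ereal (max B 0)"
    using assms(1) unfolding kothe_sup_le_iff by (auto simp: max.coboundedI1)
  also have "ereal (max B 0) < \<infinity>" by (simp only: less_ereal.simps)
  finally show "kothe_sup M j c < \<infinity>" .
qed

lemma kothe_seminorm_le:
  assumes "c \<in> kothe_space M" "0 \<le> B"
    and "\<And>k. kothe_weight M j k \<noteq> \<infinity> \<Longrightarrow> cmod (c k) * real_weight M j k \<le> B"
  shows "kothe_seminorm M j c \<le> B"
proof -
  have "kothe_sup M j c \<le> ereal B"
    using assms kothe_space_eq_0 unfolding kothe_sup_le_iff by auto
  then show ?thesis using kothe_spaceD[OF assms(1)] by simp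
qed

lemma kothe_space_add:
  assumes "x \<in> kothe_space M" "y \<in> kothe_space M"
  shows "x + y \<in> kothe_space M" "kothe_seminorm M j (x + y) \<le> kothe_seminorm M j x + kothe_seminorm M j y"
proof -
  have *: "cmod ((x + y) k) * real_weight M j k \<le> kothe_seminorm M j x + kothe_seminorm M j y" for j k
  proof -
    have "cmod ((x + y) k) * real_weight M j k \<le> (cmod (x k) + cmod (y k)) * real_weight M j k"
      by (intro mult_right_mono real_weight_nonneg) (simp add: norm_triangle_ineq plus_fun_def)
    also have "\<dots> \<le> kothe_seminorm M j x + kothe_seminorm M j y"
      using kothe_seminorm_ge[OF assms(1), of k j] kothe_seminorm_ge[OF assms(2), of k j]
      by (simp add: distrib_right)
    finally show ?thesis .
  qed
  show mem: "x + y \<in> kothe_space M"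
    using * kothe_space_eq_0[OF assms(1)] kothe_space_eq_0[OF assms(2)]
    by (intro kothe_spaceI) (auto simp: plus_fun_def intro!: exI)
  show "kothe_seminorm M j (x + y) \<le> kothe_seminorm M j x + kothe_seminorm M j y"
    using * by (intro kothe_seminorm_le mem add_nonneg_nonneg kothe_seminorm_nonneg)
qed

lemma kothe_space_scale:
  assumes "x \<in> kothe_space M"
  shows "seq_scale a x \<in> kothe_space M"
    and "kothe_seminorm M j (seq_scale a x) = cmod a * kothe_seminorm M j x"
proof -
  have *: "cmod (seq_scale a x k) * real_weight M j k \<le> cmod a * kothe_seminorm M j x"
    if "x \<in> kothe_space M" for a x j k
    using mult_left_mono[OF kothe_seminorm_ge[OF that, of k j], of "cmod a"]
    by (simp add: seq_scale_def norm_mult mult_ac)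
  have mem: "seq_scale a x \<in> kothe_space M" if "x \<in> kothe_space M" for a x
    using *[OF that] kothe_space_eq_0[OF that]
    by (intro kothe_spaceI) (auto simp: seq_scale_def intro!: exI)
  have le: "kothe_seminorm M j (seq_scale a x) \<le> cmod a * kothe_seminorm M j x"
    if "x \<in> kothe_space M" for a x
    using *[OF that] by (intro kothe_seminorm_le mem that mult_nonneg_nonneg kothe_seminorm_nonneg) auto
  show "seq_scale a x \<in> kothe_space M" using assms by (rule mem)
  show "kothe_seminorm M j (seq_scale a x) = cmod a * kothe_seminorm M j x"
  proof (cases "a = 0")
    case True
    then show ?thesis using le[OF assms, of a] kothe_seminorm_nonneg[of j "seq_scale a x"] by simp
  next
    case False
    \<comment> \<open>The missing inequality is \<open>le\<close> for the scalar
      \<open>inverse a\<close> and the sequence \<open>seq_scale a x\<close>.\<close>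
    then have "seq_scale (inverse a) (seq_scale a x) = x" by (simp add: seq_scale_def fun_eq_iff)
    then have "kothe_seminorm M j x \<le> inverse (cmod a) * kothe_seminorm M j (seq_scale a x)"
      using le[OF mem[OF assms], of "inverse a" a] by (simp add: norm_inverse)
    then show ?thesis using False le[OF assms, of a] by (simp add: field_simps)
  qed
qed

lemma kothe_space_0: "0 \<in> kothe_space M"
  by (rule kothe_spaceI) auto

lemma subspace_kothe_space: "module.subspace seq_scale (kothe_space M)"
proof -
  interpret vector_space seq_scale by (rule vector_space_seq_scale)
  show ?thesis
    by (rule subspaceI) (auto intro: kothe_space_0 kothe_space_add kothe_space_scale)
qed

lemma seminorm_on_kothe: "seminorm_on seq_scale (kothe_space M) (kothe_seminorm M j)"
  unfolding seminorm_on_def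
  by (auto intro: kothe_seminorm_nonneg kothe_space_add kothe_space_scale)

lemma kothe_seminorm_mono:
  assumes "i \<le> j" "x \<in> kothe_space M"
  shows "kothe_seminorm M i x \<le> kothe_seminorm M j x"
proof (rule kothe_seminorm_le[OF assms(2) kothe_seminorm_nonneg])
  fix k
  show "cmod (x k) * real_weight M i k \<le> kothe_seminorm M j x"
  proof (cases "kothe_weight M j k = \<infinity>")
    case True
    then show ?thesis using kothe_space_eq_0[OF assms(2) True] kothe_seminorm_nonneg by simp
  next
    case False
    then show ?thesis
      using mult_left_mono[OF real_weight_mono[OF assms(1) False], of "cmod (x k)"]
        kothe_seminorm_ge[OF assms(2), of k j] by simp
  qed
qed

lemma locally_convex_space_kothe: "locally_convex_space seq_scale (kothe_topology M)"
  unfolding locally_convex_space_def topspace_kothe_topology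
proof (intro conjI vector_space_seq_scale subspace_kothe_space exI[of _ "range (kothe_seminorm M)"])
  show "kothe_topology M = seminorm_topology (kothe_space M) (range (kothe_seminorm M))"
    by (simp add: kothe_topology_def)
qed (auto intro: seminorm_on_kothe)

lemma continuous_seminorm_kothe:
  assumes "0 \<le> C"
  shows "continuous_seminorm seq_scale (kothe_topology M) (\<lambda>x. C * kothe_seminorm M j x)"
  unfolding continuous_seminorm_def topspace_kothe_topology
proof (intro conjI seminorm_on_scale seminorm_on_kothe assms continuous_map_real_mult_left)
  show "continuous_map (kothe_topology M) euclideanreal (kothe_seminorm M j)"
    unfolding kothe_topology_def
    by (rule continuous_map_seminorm_topology[OF vector_space_seq_scale subspace_kothe_space _ seminorm_on_kothe])
      simp
qed

lemma continuous_seminorm_kothe_bound: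
  assumes "continuous_seminorm seq_scale (kothe_topology M) q"
  shows "\<exists>C j. 0 < C \<and> (\<forall>x\<in>kothe_space M. q x \<le> C * kothe_seminorm M j x)"
  using assms vector_space_seq_scale subspace_kothe_space seminorm_on_kothe kothe_seminorm_mono
  unfolding kothe_topology_def by (intro continuous_seminorm_bound)

lemma unit_seq_in_kothe_space:
  assumes "\<And>j. kothe_weight M j k \<noteq> \<infinity>"
  shows "unit_seq k \<in> kothe_space M"
proof (rule kothe_spaceI)
  fix j i show "kothe_weight M j i = \<infinity> \<Longrightarrow> unit_seq k i = 0"
    using assms by (auto simp: unit_seq_def)
  show "\<exists>B. \<forall>i. kothe_weight M j i \<noteq> \<infinity> \<longrightarrow> cmod (unit_seq k i) * real_weight M j i \<le> B"
    using real_weight_nonneg by (intro exI[of _ "real_weight M j k"]) (auto simp: unit_seq_def)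
qed

lemma kothe_seminorm_unit_seq_le:
  assumes "\<And>j. kothe_weight M j k \<noteq> \<infinity>"
  shows "kothe_seminorm M j (unit_seq k) \<le> real_weight M j k"
  by (rule kothe_seminorm_le[OF unit_seq_in_kothe_space[OF assms] real_weight_nonneg])
    (use real_weight_nonneg in \<open>auto simp: unit_seq_def\<close>)

section \<open>From nuclearity to summable weight quotients\<close>

text \<open>A trace estimate. The k-th coordinate of the expansion of \<open>unit_seq k\<close> says
  that the numbers \<open>a n (unit_seq k) * y n k\<close> sum to 1 over \<open>n\<close>. Multiply
  by the weight quotient, sum over \<open>k < K\<close> and exchange the sums: the factor with
  \<open>y n\<close> is at most its seminorm of index 1, and the weighted sum of the
  \<open>a n (unit_seq k)\<close> is at most a constant times the dual norm of
  \<open>a n\<close>.\<close>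

lemma nuclear_imp_weight_sum_bounded:
  assumes nuc: "nuclear_space seq_scale (kothe_topology M)"
    and fin: "\<And>j k. kothe_weight M j k \<noteq> \<infinity>"
  shows "\<exists>l\<ge>1. \<exists>S. \<forall>K. (\<Sum>k<K. real_weight M 1 k / real_weight M l k) \<le> S"
proof -
  let ?E = "kothe_space M" and ?p = "kothe_seminorm M 1"
  interpret vector_space seq_scale by (rule vector_space_seq_scale)
  note sub = subspace_kothe_space
  have "continuous_seminorm seq_scale (kothe_topology M) ?p"
    using continuous_seminorm_kothe[of 1 1] by simp
  then obtain q where q: "continuous_seminorm seq_scale (kothe_topology M) q"
    and nm: "nuclear_map seq_scale ?E q seq_scale ?E ?p (\<lambda>x. x)"
    using nuc unfolding nuclear_space_def topspace_kothe_topology by blast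
  obtain a y where a: "\<And>n. bounded_functional seq_scale ?E q (a n)" and y: "\<And>n. y n \<in> ?E"
    and sm: "summable (\<lambda>n. dual_norm ?E q (a n) * ?p (y n))"
    and lim: "\<And>x. x \<in> ?E \<Longrightarrow> (\<lambda>N. ?p (x - (\<Sum>n<N. seq_scale (a n x) (y n)))) \<longlonglongrightarrow> 0"
    using nm unfolding nuclear_map_def by blast
  have qsn: "seminorm_on seq_scale ?E q"
    using q unfolding continuous_seminorm_def topspace_kothe_topology by blast
  have q0: "q 0 = 0" by (rule seminorm_on_0[OF vector_space_seq_scale qsn kothe_space_0])
  obtain C l0 where C: "0 < C" "\<And>x. x \<in> ?E \<Longrightarrow> q x \<le> C * kothe_seminorm M l0 x"
    using continuous_seminorm_kothe_bound[OF q] by blast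
  \<comment> \<open>Raising \<open>l0\<close> to at least 1 keeps the bound on \<open>q\<close> and
    provides \<open>1 \<le> l\<close>, which the convexity argument for the growth condition
    requires.\<close>
  define l where "l = max 1 l0"
  have unit: "unit_seq k \<in> ?E" for k using unit_seq_in_kothe_space fin by blast
  have wl: "1 \<le> real_weight M l k" for k using real_weight_ge_1 fin by blast
  have dn: "0 \<le> dual_norm ?E q (a n)" for n
    by (rule dual_norm_nonneg[where q = q, OF qsn a kothe_space_0 q0])
  have row: "(\<Sum>k<K. cmod (a n (unit_seq k)) / real_weight M l k) \<le> C * dual_norm ?E q (a n)" for n K
  proof -
    \<comment> \<open>phases that align all values \<open>a n (unit_seq k)\<close>, so that \<open>a n z\<close> is the row sum\<close>
    define c where "c k = cnj (sgn (a n (unit_seq k))) / complex_of_real (real_weight M l k)" for k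
    define z where "z = (\<Sum>k<K. seq_scale (c k) (unit_seq k))"
    have zE: "z \<in> ?E"
      unfolding z_def using sub unit by (intro subspace_sum subspace_scale) auto
    have zk: "z i = (if i < K then c i else 0)" for i
      by (simp add: z_def sum_fun_apply seq_scale_def unit_seq_def if_distrib cong: if_cong)
    have "kothe_seminorm M l z \<le> 1"
    proof (rule kothe_seminorm_le[OF zE])
      fix i
      show "cmod (z i) * real_weight M l i \<le> 1"
      proof -
        have "cmod (complex_of_real (real_weight M l i)) = real_weight M l i"
          using wl[of i] by (simp only: norm_of_real abs_of_nonneg[OF real_weight_nonneg])
        then show ?thesis using wl[of i] by (simp add: zk c_def norm_divide norm_sgn del: norm_of_real)
      qed
    qed simp
    moreover have "kothe_seminorm M l0 z \<le> kothe_seminorm M l z"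
      using zE by (intro kothe_seminorm_mono) (simp add: l_def)
    ultimately have "C * kothe_seminorm M l0 z \<le> C * 1"
      using C(1) by (intro mult_left_mono) auto
    then have "q z \<le> C" using C(2)[OF zE] by simp
    have "a n z = (\<Sum>k<K. c k * a n (unit_seq k))"
      unfolding z_def using a[of n] unit
      by (intro functional_on_sum[OF _ vector_space_seq_scale sub]) (auto simp: bounded_functional_def)
    also have "\<dots> = (\<Sum>k<K. complex_of_real (cmod (a n (unit_seq k)) / real_weight M l k))"
    proof (rule sum.cong)
      fix k
      have "cnj (sgn w) * w = complex_of_real (cmod w)" for w
        by (cases "w = 0") (auto simp: sgn_eq complex_norm_square[symmetric] power2_eq_square
            mult.commute[of "cnj w"])
      then show "c k * a n (unit_seq k) = complex_of_real (cmod (a n (unit_seq k)) / real_weight M l k)"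
        by (simp add: c_def)
    qed simp
    finally have eq: "a n z = complex_of_real (\<Sum>k<K. cmod (a n (unit_seq k)) / real_weight M l k)" by simp
    have "(\<Sum>k<K. cmod (a n (unit_seq k)) / real_weight M l k) \<le> cmod (a n z)"
      unfolding eq norm_of_real by simp
    also have "\<dots> \<le> dual_norm ?E q (a n) * q z"
      by (rule bounded_functional_le_dual_norm[OF qsn _ a zE]) (rule kothe_space_scale)
    also have "\<dots> \<le> dual_norm ?E q (a n) * C"
      using \<open>q z \<le> C\<close> dn by (rule mult_left_mono)
    finally show ?thesis by (simp add: mult.commute)
  qed
  define S where "S = C * (\<Sum>n. dual_norm ?E q (a n) * ?p (y n))"
  have "(\<Sum>k<K. real_weight M 1 k / real_weight M l k) \<le> S" for K
  proof -
    \<comment> \<open>The k-th coordinate of the N-th partial sum for \<open>unit_seq k\<close>. It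
      tends to 1, so a bound uniform in \<open>N\<close> passes to the limit.\<close>
    define u where "u N k = (\<Sum>n<N. a n (unit_seq k) * y n k)" for N k
    have bound: "(\<Sum>k<K. cmod (u N k) * (real_weight M 1 k / real_weight M l k)) \<le> S" for N
    proof -
      have "(\<Sum>k<K. cmod (u N k) * (real_weight M 1 k / real_weight M l k))
        \<le> (\<Sum>k<K. \<Sum>n<N. ?p (y n) * (cmod (a n (unit_seq k)) / real_weight M l k))"
      proof (rule sum_mono)
        fix k
        have "cmod (u N k) \<le> (\<Sum>n<N. cmod (a n (unit_seq k)) * cmod (y n k))"
          unfolding u_def norm_mult[symmetric] by (rule norm_sum)
        then have "cmod (u N k) * (real_weight M 1 k / real_weight M l k)
          \<le> (\<Sum>n<N. cmod (a n (unit_seq k)) * cmod (y n k)) * (real_weight M 1 k / real_weight M l k)"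
          by (intro mult_right_mono divide_nonneg_nonneg real_weight_nonneg)
        also have "\<dots> = (\<Sum>n<N. (cmod (y n k) * real_weight M 1 k) * (cmod (a n (unit_seq k)) / real_weight M l k))"
          unfolding sum_distrib_right by (rule sum.cong) (simp_all add: mult_ac)
        also have "\<dots> \<le> (\<Sum>n<N. ?p (y n) * (cmod (a n (unit_seq k)) / real_weight M l k))"
          by (intro sum_mono mult_right_mono kothe_seminorm_ge y divide_nonneg_nonneg real_weight_nonneg) auto
        finally show "cmod (u N k) * (real_weight M 1 k / real_weight M l k)
          \<le> (\<Sum>n<N. ?p (y n) * (cmod (a n (unit_seq k)) / real_weight M l k))" .
      qed
      also have "\<dots> = (\<Sum>n<N. ?p (y n) * (\<Sum>k<K. cmod (a n (unit_seq k)) / real_weight M l k))"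
        by (subst sum.swap) (simp add: sum_distrib_left)
      also have "\<dots> \<le> (\<Sum>n<N. ?p (y n) * (C * dual_norm ?E q (a n)))"
        by (intro sum_mono mult_left_mono row kothe_seminorm_nonneg)
      also have "\<dots> = C * (\<Sum>n<N. dual_norm ?E q (a n) * ?p (y n))"
        by (simp add: sum_distrib_left mult_ac)
      also have "\<dots> \<le> S"
        unfolding S_def using C(1) sm dn
        by (intro mult_left_mono sum_le_suminf) (auto intro!: mult_nonneg_nonneg kothe_seminorm_nonneg)
      finally show ?thesis .
    qed
    have "(\<lambda>N. u N k) \<longlonglongrightarrow> 1" for k
    proof (rule LIM_zero_cancel, rule Lim_null_comparison[OF always_eventually lim[OF unit[of k]]], rule allI)
      fix N
      let ?d = "unit_seq k - (\<Sum>n<N. seq_scale (a n (unit_seq k)) (y n))"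
      have dE: "?d \<in> ?E"
        using sub unit y by (intro subspace_diff subspace_sum subspace_scale) auto
      have "?d k = 1 - u N k"
        by (simp add: u_def sum_fun_apply seq_scale_def unit_seq_def)
      then show "norm (u N k - 1) \<le> ?p ?d"
        using cmod_le_kothe_seminorm[OF dE, of k 1] by (simp add: norm_minus_commute)
    qed
    then have "(\<lambda>N. \<Sum>k<K. cmod (u N k) * (real_weight M 1 k / real_weight M l k))
      \<longlonglongrightarrow> (\<Sum>k<K. cmod 1 * (real_weight M 1 k / real_weight M l k))"
      by (intro tendsto_intros)
    then have "(\<Sum>k<K. cmod 1 * (real_weight M 1 k / real_weight M l k)) \<le> S"
      by (rule LIMSEQ_le_const2) (use bound in auto)
    then show ?thesis by simp
  qed
  then show ?thesis by (intro exI[of _ l] conjI exI[of _ S]) (auto simp: l_def)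
qed

section \<open>From weight decay to nuclearity\<close>

text \<open>The coordinate functionals and the unit sequences represent the identity. The square in
  the hypothesis makes the norms summable; its growth also sends the seminorms of the remainders to
  0.\<close>

lemma weight_decay_imp_nuclear:
  assumes decay: "\<And>j. \<exists>l\<ge>j. \<exists>C>0. \<forall>k. kothe_weight M l k \<noteq> \<infinity> \<longrightarrow>
    real_weight M j k * (real k + 1)\<^sup>2 \<le> C * real_weight M l k"
  shows "nuclear_space seq_scale (kothe_topology M)"
  unfolding nuclear_space_def topspace_kothe_topology
proof (intro conjI allI impI locally_convex_space_kothe)
  let ?E = "kothe_space M"
  interpret vector_space seq_scale by (rule vector_space_seq_scale)
  note sub = subspace_kothe_space
  fix p assume p: "continuous_seminorm seq_scale (kothe_topology M) p"
  then have psn: "seminorm_on seq_scale ?E p"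
    unfolding continuous_seminorm_def topspace_kothe_topology by blast
  obtain B j where B: "0 < B" "\<And>x. x \<in> ?E \<Longrightarrow> p x \<le> B * kothe_seminorm M j x"
    using continuous_seminorm_kothe_bound[OF p] by blast
  obtain l C where lC: "j \<le> l" "0 < C"
    and dec: "\<And>k. kothe_weight M l k \<noteq> \<infinity> \<Longrightarrow> real_weight M j k * (real k + 1)\<^sup>2 \<le> C * real_weight M l k"
    using decay[of j] by blast
  \<comment> \<open>The factor \<open>B\<close> ensures \<open>p x \<le> q x\<close>; it cancels in
    the products of dual norms and seminorms.\<close>
  define q where "q = (\<lambda>x. B * kothe_seminorm M l x)"
  have q0: "q 0 = 0"
    unfolding q_def using seminorm_on_0[OF vector_space_seq_scale seminorm_on_kothe kothe_space_0] by simp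
  have p0: "p 0 = 0" by (rule seminorm_on_0[OF vector_space_seq_scale psn kothe_space_0])
  define F where "F = {k. \<forall>i. kothe_weight M i k \<noteq> \<infinity>}"
  have outside: "x k = 0" if "x \<in> ?E" "k \<notin> F" for x k
    using that kothe_space_eq_0 unfolding F_def by blast
  define a where "a = (\<lambda>n (x :: nat \<Rightarrow> complex). x n)"
  \<comment> \<open>outside \<open>F\<close> the unit sequence is not in the space, but all sequences of the space vanish\<close>
  define y where "y = (\<lambda>n. if n \<in> F then unit_seq n else 0)"
  have yE: "y n \<in> ?E" for n
    using unit_seq_in_kothe_space kothe_space_0 by (auto simp: y_def F_def)
  have aq: "cmod (a n x) \<le> 1 / B * q x" if "x \<in> ?E" for n x
    using B(1) cmod_le_kothe_seminorm[OF that] by (simp add: a_def q_def)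
  have qsn: "seminorm_on seq_scale ?E q"
    unfolding q_def using B(1) by (intro seminorm_on_scale seminorm_on_kothe) simp
  have bf: "bounded_functional seq_scale ?E q (a n)" for n
    unfolding bounded_functional_def functional_on_def
    using aq[of _ n] by (auto simp: a_def seq_scale_def plus_fun_def intro!: exI[of _ "1 / B"])
  \<comment> \<open>For \<open>n \<in> F\<close> the two factors are at most
    \<open>1 / (B * real_weight M l n)\<close> and \<open>B * real_weight M j n\<close>, so the
    decay hypothesis bounds their product.\<close>
  have upper: "dual_norm ?E q (a n) * p (y n) \<le> C * inverse ((real (Suc n))\<^sup>2)" for n
  proof (cases "n \<in> F")
    case True
    then have nF: "\<And>i. kothe_weight M i n \<noteq> \<infinity>" by (simp add: F_def)
    have wl: "1 \<le> real_weight M l n" by (rule real_weight_ge_1[OF nF])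
    have "dual_norm ?E q (a n) \<le> 1 / (B * real_weight M l n)"
    proof (rule dual_norm_le[where q = q, OF kothe_space_0 q0])
      fix x assume x: "x \<in> ?E"
      show "cmod (a n x) \<le> 1 / (B * real_weight M l n) * q x"
        using kothe_seminorm_ge[OF x, of n l] wl B(1) by (simp add: a_def q_def field_simps)
    qed (use wl B(1) in simp)
    moreover have "p (y n) \<le> B * real_weight M j n"
    proof -
      have "p (y n) \<le> B * kothe_seminorm M j (unit_seq n)"
        using B(2)[OF yE, of n] True by (simp add: y_def)
      also have "\<dots> \<le> B * real_weight M j n"
        using B(1) by (intro mult_left_mono kothe_seminorm_unit_seq_le nF) simp
      finally show ?thesis .
    qed
    moreover have "0 \<le> p (y n)" using psn yE unfolding seminorm_on_def by blast
    ultimately have "dual_norm ?E q (a n) * p (y n) \<le> 1 / (B * real_weight M l n) * (B * real_weight M j n)"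
      using wl B(1) by (intro mult_mono) auto
    also have "\<dots> = real_weight M j n / real_weight M l n" using B(1) by simp
    also have "\<dots> \<le> C * inverse ((real (Suc n))\<^sup>2)"
      using dec[OF nF] wl by (simp add: field_simps)
    finally show ?thesis .
  next
    case False
    then show ?thesis using p0 lC(2) by (simp add: y_def)
  qed
  have "summable (\<lambda>n. C * inverse ((real (Suc n))\<^sup>2))"
    using inverse_squares_sums by (intro summable_mult) (auto simp: sums_iff inverse_eq_divide)
  then have sm: "summable (\<lambda>n. dual_norm ?E q (a n) * p (y n))"
  proof (rule summable_comparison_test'[where N = 0])
    fix n
    have "0 \<le> dual_norm ?E q (a n) * p (y n)"
      using dual_norm_nonneg[where q = q, OF qsn bf kothe_space_0 q0] psn yE
      unfolding seminorm_on_def by (intro mult_nonneg_nonneg) auto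
    then show "norm (dual_norm ?E q (a n) * p (y n)) \<le> C * inverse ((real (Suc n))\<^sup>2)"
      using upper[of n] by simp
  qed
  have lim: "(\<lambda>N. p (x - (\<Sum>n<N. seq_scale (a n x) (y n)))) \<longlonglongrightarrow> 0" if x: "x \<in> ?E" for x
  proof -
    have "\<forall>N. norm (p (x - (\<Sum>n<N. seq_scale (a n x) (y n)))) \<le> B * C * kothe_seminorm M l x * inverse (real (Suc N))"
    proof
      fix N
      define z where "z = x - (\<Sum>n<N. seq_scale (a n x) (y n))"
      have zE: "z \<in> ?E"
        unfolding z_def using sub x yE by (intro subspace_diff subspace_sum subspace_scale) auto
      have zk: "z k = (if k < N then 0 else x k)" for k
      proof -
        have "seq_scale (a n x) (y n) k = (if n = k then x k else 0)" for n
          using outside[OF x] by (auto simp: a_def y_def seq_scale_def unit_seq_def)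
        then show ?thesis by (simp add: z_def sum_fun_apply)
      qed
      \<comment> \<open>The remainder \<open>z\<close> is the tail of \<open>x\<close> from
        \<open>N\<close> on, where \<open>(k + 1)^2\<close> is at least \<open>N + 1\<close>. Where
        the weight of index \<open>l\<close> is infinite, \<open>x\<close> vanishes.\<close>
      have "kothe_seminorm M j z \<le> C * kothe_seminorm M l x * inverse (real (Suc N))"
      proof (rule kothe_seminorm_le[OF zE])
        fix k
        have rhs: "0 \<le> C * kothe_seminorm M l x * inverse (real (Suc N))"
          using lC(2) kothe_seminorm_nonneg[of l x] by simp
        then show "0 \<le> C * kothe_seminorm M l x * inverse (real (Suc N))" .
        show "cmod (z k) * real_weight M j k \<le> C * kothe_seminorm M l x * inverse (real (Suc N))"
        proof (cases "N \<le> k \<and> kothe_weight M l k \<noteq> \<infinity>")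
          case False
          then have "z k = 0" using kothe_space_eq_0[OF x] by (auto simp: zk)
          then show ?thesis using rhs by simp
        next
          case True
          have "real (Suc N) \<le> (real k + 1)\<^sup>2"
          proof -
            have "real (Suc N) \<le> (real k + 1) * 1" using True by simp
            also have "\<dots> \<le> (real k + 1) * (real k + 1)" by (intro mult_left_mono) auto
            finally show ?thesis by (simp add: power2_eq_square)
          qed
          then have "cmod (z k) * real_weight M j k * real (Suc N) \<le> cmod (z k) * real_weight M j k * (real k + 1)\<^sup>2"
            by (intro mult_left_mono mult_nonneg_nonneg real_weight_nonneg) auto
          also have "\<dots> = cmod (z k) * (real_weight M j k * (real k + 1)\<^sup>2)" by simp
          also have "\<dots> \<le> cmod (z k) * (C * real_weight M l k)"
            using dec True by (intro mult_left_mono) auto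
          also have "\<dots> \<le> C * kothe_seminorm M l x"
            using True kothe_seminorm_ge[OF x, of k l] lC(2) by (simp add: zk mult_ac)
          finally show ?thesis by (simp add: field_simps)
        qed
      qed
      then have "p z \<le> B * (C * kothe_seminorm M l x * inverse (real (Suc N)))"
        using B(2)[OF zE] B(1) by (meson mult_left_mono less_imp_le order_trans)
      moreover have "0 \<le> p z" using psn zE unfolding seminorm_on_def by blast
      ultimately show "norm (p (x - (\<Sum>n<N. seq_scale (a n x) (y n)))) \<le> B * C * kothe_seminorm M l x * inverse (real (Suc N))"
        by (simp add: z_def[symmetric] mult.assoc)
    qed
    moreover have "(\<lambda>N. B * C * kothe_seminorm M l x * inverse (real (Suc N))) \<longlonglongrightarrow> 0"
      using tendsto_mult_left[OF LIMSEQ_inverse_real_of_nat, of "B * C * kothe_seminorm M l x"] by simp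
    ultimately show ?thesis by (rule Lim_null_comparison[OF always_eventually])
  qed
  have "p x \<le> q x" if "x \<in> ?E" for x
  proof -
    have "p x \<le> B * kothe_seminorm M j x" using B(2) that .
    also have "\<dots> \<le> q x"
      unfolding q_def using B(1) kothe_seminorm_mono[OF lC(1) that] by (intro mult_left_mono) auto
    finally show ?thesis .
  qed
  moreover have "continuous_seminorm seq_scale (kothe_topology M) q"
    unfolding q_def using B(1) by (intro continuous_seminorm_kothe) simp
  moreover have "nuclear_map seq_scale ?E q seq_scale ?E p (\<lambda>x. x)"
    unfolding nuclear_map_def using bf yE sm lim by blast
  ultimately show "\<exists>q. continuous_seminorm seq_scale (kothe_topology M) q \<and> (\<forall>x\<in>?E. p x \<le> q x) \<and>
      nuclear_map seq_scale ?E q seq_scale ?E p (\<lambda>x. x)"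
    by blast
qed

section \<open>The growth condition in terms of the weights\<close>

lemma associated_function_real_weight:
  assumes "kothe_weight M j k \<noteq> \<infinity>"
  shows "associated_function M (real j * sqrt (real k)) = ereal (ln (real_weight M j k))"
  using assms associated_function_nonneg[of "real j * sqrt (real k)"] unfolding kothe_weight_def
  by (cases "associated_function M (real j * sqrt (real k))") (auto simp: ereal_exp_def)

text \<open>The condition is applied successively at \<open>t\<close>, \<open>H * t\<close>, and so
  on. Since \<open>H > 1\<close>, the logarithm gained at each step is at least \<open>ln t\<close>,
  at the cost of one summand \<open>H\<close>.\<close>

lemma associated_function_iterate:
  assumes H: "1 < H" and t: "0 < t"
    and cond: "\<And>t. 0 < t \<Longrightarrow>
      associated_function M t + ereal (ln t) \<le> associated_function M (H * t) + ereal H"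
  shows "associated_function M t + ereal (real n * ln t)
    \<le> associated_function M (H ^ n * t) + ereal (real n * H)"
proof (induction n)
  case 0
  show ?case by (simp flip: zero_ereal_def)
next
  case (Suc n)
  let ?A = "associated_function M"
  have 1: "?A (H ^ n * t) + ereal (ln (H ^ n * t)) \<le> ?A (H ^ Suc n * t) + ereal H"
    using cond[of "H ^ n * t"] H t by (simp add: mult.assoc)
  have "1 * t \<le> H ^ n * t" using H t by (intro mult_right_mono one_le_power) auto
  then have 2: "ln t \<le> ln (H ^ n * t)" using t by simp
  have "0 \<le> ?A t" "0 \<le> ?A (H ^ n * t)" "0 \<le> ?A (H ^ Suc n * t)"
    by (rule associated_function_nonneg)+
  then show ?case using 1 2 Suc.IH
    by (cases "?A t"; cases "?A (H ^ n * t)"; cases "?A (H ^ Suc n * t)") (auto simp: algebra_simps)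
qed

text \<open>Four iterations at a point \<open>t\<close> with \<open>t \<ge> sqrt k\<close> gain
  \<open>t ^ 4 \<ge> k^2\<close>. The factor \<open>exp (4 * H)\<close> is their cost, and the
  factor 4 comes from \<open>k + 1 \<le> 2 * k\<close> for \<open>k \<ge> 1\<close>.\<close>

lemma weight_decay:
  assumes H: "1 < H"
    and cond: "\<And>t. 0 < t \<Longrightarrow>
      associated_function M t + ereal (ln t) \<le> associated_function M (H * t) + ereal H"
  shows "\<exists>l\<ge>j. \<exists>C>0. \<forall>k. kothe_weight M l k \<noteq> \<infinity> \<longrightarrow>
    real_weight M j k * (real k + 1)\<^sup>2 \<le> C * real_weight M l k"
proof -
  \<comment> \<open>For \<open>j = 0\<close> the argument of the associated function would be 0;
    with \<open>i \<ge> 1\<close> it is at least \<open>sqrt k\<close>.\<close>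
  define i where "i = max j 1"
  \<comment> \<open>Four iterations multiply the argument by \<open>H ^ 4\<close>; the index of a
    weight must be an integer, so it is rounded up and monotonicity applies.\<close>
  define l where "l = nat \<lceil>H ^ 4 * real i\<rceil>"
  have li: "H ^ 4 * real i \<le> real l" unfolding l_def by (rule of_nat_ceiling)
  have "1 * real i \<le> H ^ 4 * real i" using H by (intro mult_right_mono one_le_power) auto
  then have il: "i \<le> l" using li by simp
  have "real_weight M j k * (real k + 1)\<^sup>2 \<le> 4 * exp (4 * H) * real_weight M l k"
    if fin: "kothe_weight M l k \<noteq> \<infinity>" for k
  proof (cases "k = 0")
    case True
    \<comment> \<open>At \<open>k = 0\<close> both weights are \<open>exp 0 = 1\<close>, so a
      constant of at least 1 suffices.\<close>
    have "1 * 1 \<le> 4 * exp (4 * H)" using H by (intro mult_mono) auto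
    then show ?thesis
      using True by (simp add: kothe_weight_def associated_function_def ereal_exp_def zero_ereal_def)
  next
    case False
    define t where "t = real i * sqrt (real k)"
    have fin': "kothe_weight M i k \<noteq> \<infinity>"
      using fin kothe_weight_mono[OF il, of k] by auto
    have wi: "1 \<le> real_weight M i k" and wl: "1 \<le> real_weight M l k"
      using real_weight_ge_1 fin fin' by auto
    have t: "sqrt (real k) \<le> t" unfolding t_def i_def
      using mult_right_mono[of 1 "real (max j 1)" "sqrt (real k)"] by simp
    have tpos: "0 < t" using t False by (meson of_nat_0_less_iff order_less_le_trans real_sqrt_gt_zero gr0I)
    have "associated_function M t + ereal (real 4 * ln t)
      \<le> associated_function M (H ^ 4 * t) + ereal (real 4 * H)"
      by (rule associated_function_iterate[OF H tpos cond])
    also have "\<dots> \<le> associated_function M (real l * sqrt (real k)) + ereal (real 4 * H)"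
      using mult_right_mono[OF li, of "sqrt (real k)"] H tpos
      by (intro add_right_mono associated_function_mono) (auto simp: t_def mult.assoc)
    finally have "ln (real_weight M i k) + 4 * ln t \<le> ln (real_weight M l k) + 4 * H"
      unfolding t_def associated_function_real_weight[OF fin] associated_function_real_weight[OF fin']
      by simp
    then have "exp (ln (real_weight M i k) + 4 * ln t) \<le> exp (ln (real_weight M l k) + 4 * H)" by simp
    moreover have "exp (4 * ln t) = t ^ 4" using tpos exp_of_nat_mult[of 4 "ln t"] by simp
    ultimately have main: "real_weight M i k * t ^ 4 \<le> real_weight M l k * exp (4 * H)"
      using wi wl by (simp add: exp_add)
    have "(real k + 1)\<^sup>2 \<le> (2 * real k)\<^sup>2" using False by (intro power_mono) auto
    also have "\<dots> = 4 * sqrt (real k) ^ 4"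
      by (simp add: power_mult_distrib power4_eq_xxxx power2_eq_square)
    also have "\<dots> \<le> 4 * t ^ 4" using t by (intro mult_left_mono power_mono) auto
    finally have "real_weight M j k * (real k + 1)\<^sup>2 \<le> real_weight M i k * (4 * t ^ 4)"
      using real_weight_mono[of j i k] fin' wi by (intro mult_mono) (auto simp: i_def)
    also have "\<dots> \<le> 4 * exp (4 * H) * real_weight M l k" using main by (simp add: mult_ac)
    finally show ?thesis .
  qed
  then show ?thesis using il by (intro exI[of _ l] conjI exI[of _ "4 * exp (4 * H)"]) (auto simp: i_def)
qed

text \<open>A decreasing sequence with bounded partial sums is \<open>O(1/K)\<close>. The logarithm
  of this bound is a growth condition at \<open>sqrt K\<close>; monotonicity carries it over to all
  \<open>t \<ge> 1\<close>.\<close>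

lemma weight_sum_bounded_imp_growth:
  assumes fin: "\<And>t. 0 \<le> t \<Longrightarrow> associated_function M t \<noteq> \<infinity>"
    and l: "1 \<le> l" and S: "\<And>K. (\<Sum>k<K. real_weight M 1 k / real_weight M l k) \<le> S"
  shows "\<exists>H>1. \<forall>t>0. associated_function M t + ereal (ln t) \<le> associated_function M (H * t) + ereal H"
proof -
  define m where "m t = real_of_ereal (associated_function M t)" for t
  have m: "associated_function M t = ereal (m t)" if "0 \<le> t" for t
    using associated_function_nonneg[of t] fin[OF that] unfolding m_def
    by (cases "associated_function M t") auto
  have m_mono: "m s \<le> m t" if "0 \<le> s" "s \<le> t" for s t
    using associated_function_mono[OF that] that by (simp add: m)
  have A: "associated_function M t = (SUP p. ereal (ln (t ^ p * M 0 / M p)))" if "0 < t" for t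
    using that by (simp add: associated_function_def)
  have up: "ln (t ^ p * M 0 / M p) \<le> m t" if "0 < t" for t p
  proof -
    have "ereal (ln (t ^ p * M 0 / M p)) \<le> ereal (m t)"
      unfolding m[OF less_imp_le[OF that], symmetric] A[OF that] by (rule SUP_upper) simp
    then show ?thesis by simp
  qed
  have least: "m t \<le> B" if "0 < t" "\<And>p. ln (t ^ p * M 0 / M p) \<le> B" for t B
  proof -
    have "ereal (m t) \<le> ereal B"
      unfolding m[OF less_imp_le[OF that(1)], symmetric] A[OF that(1)] by (rule SUP_least) (simp add: that(2))
    then show ?thesis by simp
  qed
  have lnp: "ln (t ^ p * M 0 / M p) = real p * ln t + ln (M 0 / M p)" if "0 < t" for t p
    using that M_pos[of 0] M_pos[of p] by (simp add: ln_mult ln_div ln_realpow)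
  \<comment> \<open>convexity of \<open>m\<close> in \<open>log t\<close>: two terms of the suprema on the left can be exchanged\<close>
  have exch: "m (real l * s) + m t \<le> m (real l * t) + m s" if st: "0 < s" "s \<le> t" for s t
  proof -
    have t: "0 < t" and l0: "0 < real l" using st l by auto
    have lt: "0 < real l * t" "0 < real l * s" using t l0 st by auto
    have lns: "ln s \<le> ln t" "0 \<le> ln (real l)" using st l by auto
    have "ln ((real l * s) ^ p * M 0 / M p) + ln (t ^ r * M 0 / M r) \<le> m (real l * t) + m s" for p r
    proof (cases "r \<le> p")
      case True
      \<comment> \<open>Here \<open>p\<close> is moved to \<open>l * t\<close> and \<open>r\<close>
        to \<open>s\<close>; this product is the resulting gain.\<close>
      have "0 \<le> (real p - real r) * (ln t - ln s)" using True lns by (intro mult_nonneg_nonneg) auto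
      then show ?thesis
        using up[OF lt(1), of p] up[OF st(1), of r] l0 t st
        unfolding lnp[OF lt(1)] lnp[OF lt(2)] lnp[OF t] lnp[OF st(1)]
        by (simp add: ln_mult algebra_simps)
    next
      case False
      \<comment> \<open>Now the larger exponent \<open>r\<close> is moved to \<open>l * t\<close>
        and \<open>p\<close> to \<open>s\<close>. The gain is nonnegative because
        \<open>l \<ge> 1\<close>.\<close>
      have "0 \<le> (real r - real p) * ln (real l)" using False lns by (intro mult_nonneg_nonneg) auto
      then show ?thesis
        using up[OF lt(1), of r] up[OF st(1), of p] l0 t st
        unfolding lnp[OF lt(1)] lnp[OF lt(2)] lnp[OF t] lnp[OF st(1)]
        by (simp add: ln_mult algebra_simps)
    qed
    \<comment> \<open>The suprema over \<open>p\<close> and \<open>r\<close> are taken one after the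
      other, each by \<open>least\<close>.\<close>
    then have "ln ((real l * s) ^ p * M 0 / M p) \<le> m (real l * t) + m s - ln (t ^ r * M 0 / M r)" for p r
      by (simp add: le_diff_eq)
    then have "m (real l * s) \<le> m (real l * t) + m s - ln (t ^ r * M 0 / M r)" for r
      by (intro least[OF lt(2)])
    then have "ln (t ^ r * M 0 / M r) \<le> m (real l * t) + m s - m (real l * s)" for r
      by (simp add: algebra_simps)
    then have "m t \<le> m (real l * t) + m s - m (real l * s)" by (intro least[OF t])
    then show ?thesis by simp
  qed
  have w: "real_weight M j k = exp (m (real j * sqrt (real k)))" for j k
    by (simp add: kothe_weight_def m ereal_exp_def)
  define D where "D k = exp (m (sqrt (real k)) - m (real l * sqrt (real k)))" for k
  have Dw: "real_weight M 1 k / real_weight M l k = D k" for k by (simp add: w D_def exp_diff)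
  have KD: "real K * D K \<le> S" for K
  proof -
    \<comment> \<open>This is \<open>exch\<close> at the square roots of \<open>k\<close> and
      \<open>K\<close>; it needs a positive first argument, so the sum starts at
      \<open>k = 1\<close>.\<close>
    have "D K \<le> D k" if "k \<in> {1..K}" for k
      using exch[of "sqrt (real k)" "sqrt (real K)"] that by (simp add: D_def)
    then have "real K * D K \<le> (\<Sum>k\<in>{1..K}. D k)"
      using sum_mono[of "{1..K}" "\<lambda>_. D K" D] by simp
    also have "\<dots> \<le> (\<Sum>k<Suc K. D k)"
      by (rule sum_mono2) (auto simp: D_def)
    also have "\<dots> \<le> S" using S[of "Suc K"] unfolding Dw .
    finally show ?thesis .
  qed
  have S0: "0 < S" using KD[of 1] by (simp add: D_def) (meson exp_gt_zero order_less_le_trans)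
  \<comment> \<open>The additive \<open>H\<close> absorbs \<open>ln S\<close>. The multiplicative
    \<open>H\<close> absorbs \<open>l\<close> and the factor 2 lost in passing from \<open>t\<close>
    to \<open>sqrt K\<close>; it exceeds 1 since \<open>l \<ge> 1\<close>.\<close>
  define H where "H = max (2 * real l) (ln S)"
  have H: "2 * real l \<le> H" "ln S \<le> H" "1 < H" using l by (auto simp: H_def)
  have "m t + ln t \<le> m (H * t) + H" if t: "0 < t" for t
  proof (cases "t < 1")
    case True
    have "t \<le> H * t" using H(3) t by simp
    then have "m t \<le> m (H * t)" using t by (intro m_mono) auto
    then show ?thesis using True t H(3) ln_less_zero[of t] by linarith
  next
    case False
    \<comment> \<open>For \<open>t \<ge> 1\<close> this choice gives
      \<open>t \<le> sqrt K \<le> 2 * t\<close>, since \<open>K \<le> t^2 + 1 \<le> 4 * t^2\<close>,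
      and also \<open>t \<le> K\<close>.\<close>
    define K where "K = nat \<lceil>t\<^sup>2\<rceil>"
    have t1: "1 \<le> t" "1 \<le> t\<^sup>2" using False by (auto simp: one_le_power)
    have K: "t\<^sup>2 \<le> real K" "real K \<le> t\<^sup>2 + 1"
      using t1 unfolding K_def by linarith+
    have "t \<le> sqrt (real K)" using K(1) real_le_rsqrt by blast
    have "(2 * t)\<^sup>2 = 4 * t\<^sup>2" by (simp add: power_mult_distrib)
    then have "real K \<le> (2 * t)\<^sup>2" using K(2) t1(2) by linarith
    then have "sqrt (real K) \<le> 2 * t" using t by (intro real_le_lsqrt) auto
    have K1: "1 \<le> real K" using K t1 by linarith
    have "t * 1 \<le> t * t" using t1 t by (intro mult_left_mono) auto
    then have "t \<le> real K" using K(1) by (simp add: power2_eq_square)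
    then have "ln t \<le> ln (real K)" using t by simp
    have "ln (real K * D K) \<le> ln S" using KD[of K] K1 S0 by (simp add: D_def)
    then have "ln (real K) + m (sqrt (real K)) \<le> m (real l * sqrt (real K)) + ln S"
      using K1 by (simp add: D_def ln_mult)
    moreover have "real l * sqrt (real K) \<le> H * t"
    proof -
      have "real l * sqrt (real K) \<le> real l * (2 * t)"
        using \<open>sqrt (real K) \<le> 2 * t\<close> by (intro mult_left_mono) auto
      also have "\<dots> \<le> H * t" using mult_right_mono[OF H(1), of t] t by simp
      finally show ?thesis .
    qed
    then have "m (real l * sqrt (real K)) \<le> m (H * t)" by (intro m_mono) auto
    moreover have "m t \<le> m (sqrt (real K))" using t \<open>t \<le> sqrt (real K)\<close> by (intro m_mono) auto
    ultimately show ?thesis using H(2) \<open>ln t \<le> ln (real K)\<close> by linarith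
  qed
  then show ?thesis using H(3) by (intro exI[of _ H]) (simp add: m)
qed

text \<open>By monotonicity the associated function is infinite from \<open>s\<close> on. With
  \<open>H = max 2 s\<close>, either \<open>H * t\<close> lies there and the right side is infinite,
  or \<open>t < 1\<close>, where \<open>ln t\<close> is negative and monotonicity suffices.\<close>

lemma growth_of_infinite_associated_function:
  assumes s: "0 \<le> s" "associated_function M s = \<infinity>"
  shows "\<exists>H>1. \<forall>t>0. associated_function M t + ereal (ln t) \<le> associated_function M (H * t) + ereal H"
proof (intro exI[of _ "max 2 s"] conjI allI impI)
  fix t :: real assume t: "0 < t"
  show "associated_function M t + ereal (ln t) \<le> associated_function M (max 2 s * t) + ereal (max 2 s)"
  proof (cases "s \<le> max 2 s * t")
    case True
    have "associated_function M (max 2 s * t) = \<infinity>"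
      using associated_function_mono[OF s(1) True] s(2) by simp
    then show ?thesis by simp
  next
    case False
    have "max 2 s * t < max 2 s * 1" using False by simp
    then have "t < 1" by (rule mult_left_less_imp_less) simp
    have "1 * t \<le> max 2 s * t" using t by (intro mult_right_mono) auto
    then have "associated_function M t \<le> associated_function M (max 2 s * t)"
      using t by (intro associated_function_mono) auto
    moreover have "ln t \<le> max 2 s" using ln_less_zero[OF t \<open>t < 1\<close>] by linarith
    then have "ereal (ln t) \<le> ereal (max 2 s)" by (simp only: ereal_less_eq)
    ultimately show ?thesis by (rule add_mono)
  qed
qed simp

end

section \<open>Equivalence of nuclearity and the growth condition\<close>

theorem theorem2p2:
  fixes M :: "nat \<Rightarrow> real"
  assumes "\<And>p. 0 < M p"
    and "\<exists>c>0. \<forall>p\<ge>1. c \<le> (M p / M 0) powr (1 / real p)"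
  shows "nuclear_space seq_scale (kothe_topology M) \<longleftrightarrow>
    (\<exists>H::real. 1 < H \<and> (\<forall>t::real. 0 < t \<longrightarrow>
       associated_function M t + ereal (ln t) \<le> associated_function M (H * t) + ereal H))"
proof
  assume nuc: "nuclear_space seq_scale (kothe_topology M)"
  show "\<exists>H::real. 1 < H \<and> (\<forall>t::real. 0 < t \<longrightarrow>
       associated_function M t + ereal (ln t) \<le> associated_function M (H * t) + ereal H)"
  proof (cases "\<exists>s\<ge>0. associated_function M s = \<infinity>")
    case True
    then show ?thesis using growth_of_infinite_associated_function[of M] assms(1) by blast
  next
    case False
    then have fin: "\<And>t. 0 \<le> t \<Longrightarrow> associated_function M t \<noteq> \<infinity>" by blast
    \<comment> \<open>Finite weights place every unit sequence in the space, as the trace estimate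
      requires.\<close>
    have "kothe_weight M j k \<noteq> \<infinity>" for j k
      using fin[of "real j * sqrt (real k)"] unfolding kothe_weight_def
      by (cases "associated_function M (real j * sqrt (real k))") (auto simp: ereal_exp_def)
    then obtain l S where lS: "1 \<le> l" "\<And>K. (\<Sum>k<K. real_weight M 1 k / real_weight M l k) \<le> S"
      using nuclear_imp_weight_sum_bounded[where M = M, OF assms(1) nuc] by blast
    then show ?thesis using weight_sum_bounded_imp_growth[where M = M, OF assms(1) fin lS] by blast
  qed
next
  assume "\<exists>H::real. 1 < H \<and> (\<forall>t::real. 0 < t \<longrightarrow>
       associated_function M t + ereal (ln t) \<le> associated_function M (H * t) + ereal H)"
  then obtain H where H: "1 < H" "\<And>t. 0 < t \<Longrightarrow>
       associated_function M t + ereal (ln t) \<le> associated_function M (H * t) + ereal H" by blast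
  show "nuclear_space seq_scale (kothe_topology M)"
    by (rule weight_decay_imp_nuclear[where M = M, OF assms(1) weight_decay[where M = M, OF assms(1) H]])
qed

end
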